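(* Let $p > 3$ be a prime number. If $p \equiv 3 \bmod 4$ (resp. $p \equiv 1 \bmod 4$), suppose that $p - 1 = 2m$ (resp. $p + 1 = 2m$), where $m$ is an odd integer. Then the state diagram given by the map $a \mapsto 4a(a+1)$ on $D_0 \cap (D_0 - 1)$ if $p \equiv 3 \bmod 4$ (resp. on $D_1 \cap (D_0 - 1)$ if $p \equiv 1 \bmod 4$) consists of, for each divisor $d \neq 1$ of $m$, $n_d := \varphi(d)/(2\, \mathrm{ord}_d'\, 2)$ cycles of period $c_d := \mathrm{ord}_d'\, 2$, where $\varphi$ is Euler's totient function.
   Context: $\mathbb{F}_p$ is the finite field with $p$ elements. $D_0, D_1 \subset \mathbb{F}_p$ denote the set of non-zero quadratic residues modulo $p$ and the set of quadratic non-residues modulo $p$, respectively. For an integer $b$, $D_i - b = \{c \in \mathbb{F}_p \mid c + b \in D_i\}$; thus $a \in D_i \cap (D_0 - 1)$ means $a \in D_i$ and $a+1 \in D_0$. For an odd integer $d$, $\mathrm{ord}_d'\, 2$ is the least positive integer $k$ such that $2^k \equiv \pm 1 \bmod d$. The state diagram of a self-map $f$ of a finite set $X$ is the directed graph with vertex set $X$ and an edge from $a$ to $f(a)$ for each $a \in X$. The map $a \mapsto 4a(a+1)$ maps the indicated set to itself. The assertion is that the state diagram on the indicated set is the disjoint union, over all positive divisors $d \neq 1$ of $m$, of $n_d$ cycles of length $c_d$. *)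

theory Defs
  imports
    "HOL-Number_Theory.Number_Theory"
    "HOL-Computational_Algebra.Nth_Powers"
    "HOL-Library.Cardinality"
    "Graph_Theory.Digraph_Isomorphism"
begin

definition nonzero_squares :: "'a::field set"  (\<open>D\<^sub>0\<close>) where
  "D\<^sub>0 = {a. a \<noteq> 0 \<and> is_square a}"

definition nonsquares :: "'a::field set"  (\<open>D\<^sub>1\<close>) where
  "D\<^sub>1 = {a. \<not> is_square a}"

text \<open>The translate \<open>D - b\<close> of a set \<open>D\<close> by an integer \<open>b\<close>.\<close>

definition translate :: "'a::ring_1 set \<Rightarrow> int \<Rightarrow> 'a set"  (infixl \<open>\<ominus>\<close> 75) where
  "D \<ominus> b = {c. c + of_int b \<in> D}"

text \<open>\<open>ord2' d\<close> is the least \<open>k > 0\<close> with \<open>2 ^ k\<close> congruent to \<open>1\<close> or \<open>-1\<close> modulo \<open>d\<close>;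
  it is only meaningful for odd \<open>d\<close>, where such a \<open>k\<close> exists.\<close>

definition ord2' :: "nat \<Rightarrow> nat" where
  "ord2' d = (LEAST k. k > 0 \<and> ([(2::int) ^ k = 1] (mod int d) \<or> [(2::int) ^ k = - 1] (mod int d)))"

text \<open>The digraph below is well-formed only if \<open>f\<close> maps \<open>X\<close> into itself. Since
  \<^const>\<open>digraph_iso\<close> requires its first argument to be a well-formed digraph,
  an isomorphism out of \<open>state_diagram f X\<close> includes the statement that \<open>f\<close> maps \<open>X\<close> into \<open>X\<close>.\<close>

definition state_diagram :: "('a \<Rightarrow> 'a) \<Rightarrow> 'a set \<Rightarrow> ('a, 'a \<times> 'a) pre_digraph" where
  "state_diagram f X = \<lparr> verts = X, arcs = (\<lambda>a. (a, f a)) ` X, tail = fst, head = snd \<rparr>"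

text \<open>The directed cycle of length \<open>c\<close>; for \<open>c = 1\<close> it is a single vertex with a loop.\<close>

definition cycle_digraph :: "nat \<Rightarrow> (nat, nat \<times> nat) pre_digraph" where
  "cycle_digraph c = state_diagram (\<lambda>i. (i + 1) mod c) {..<c}"

definition disjoint_union_digraph ::
    "'i set \<Rightarrow> ('i \<Rightarrow> ('a, 'b) pre_digraph) \<Rightarrow> ('i \<times> 'a, 'i \<times> 'b) pre_digraph" where
  "disjoint_union_digraph I G =
     \<lparr> verts = (SIGMA i:I. verts (G i)),
       arcs = (SIGMA i:I. arcs (G i)),
       tail = (\<lambda>(i, e). (i, tail (G i) e)),
       head = (\<lambda>(i, e). (i, head (G i) e)) \<rparr>"

definition cycle_length :: "nat \<Rightarrow> nat" where
  "cycle_length d = ord2' d"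

text \<open>The division here is truncating, so statements about \<open>cycle_count d\<close> should
  also assert that \<open>2 * ord2' d\<close> divides \<open>totient d\<close>.\<close>

definition cycle_count :: "nat \<Rightarrow> nat" where
  "cycle_count d = totient d div (2 * ord2' d)"

text \<open>For each divisor \<open>d \<noteq> 1\<close> of \<open>m\<close>, exactly \<open>cycle_count d\<close> disjoint cycles of
  length \<open>cycle_length d\<close>, indexed by \<open>(d, j)\<close> with \<open>j < cycle_count d\<close>.\<close>

definition cycle_union :: "nat \<Rightarrow> ((nat \<times> nat) \<times> nat, (nat \<times> nat) \<times> (nat \<times> nat)) pre_digraph" where
  "cycle_union m =
     disjoint_union_digraph {(d, j). d dvd m \<and> d \<noteq> 1 \<and> j < cycle_count d}
       (\<lambda>(d, j). cycle_digraph (cycle_length d))"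

end

theory Submission
  imports "HOL-Algebra.Algebraic_Closure_Type" Defs
begin

text \<open>Put \<open>a = (x + 1/x - 2) / 4\<close>. Then \<open>a \<mapsto> 4 a (a + 1)\<close> becomes \<open>x \<mapsto> x\<^sup>2\<close>, and \<open>a\<close>
  determines \<open>x\<close> up to inversion. With \<open>x = y\<^sup>2\<close> one has \<open>a = ((y - 1/y) / 2)\<^sup>2\<close> and
  \<open>a + 1 = ((y + 1/y) / 2)\<^sup>2\<close>, and the Frobenius map fixes \<open>y\<close> if \<open>y\<close> has order dividing
  \<open>p - 1\<close> and inverts it if the order divides \<open>p + 1\<close>. Hence the set in question corresponds to
  the \<open>m\<close>-th roots of unity \<open>x \<noteq> 1\<close> in an algebraic closure, up to inversion. There are
  \<open>totient d / 2\<close> such pairs \<open>{x, 1/x}\<close> of order \<open>d\<close>, and \<open>x ^ (2 ^ k)\<close> is \<open>x\<close> or \<open>1/x\<close> iff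
  \<open>2 ^ k\<close> is \<open>1\<close> or \<open>-1\<close> modulo \<open>d\<close>; so all of them lie on cycles of length \<open>ord2' d\<close>.\<close>

hide_const (open) Divisibility.prime

subsection \<open>Cycles of a self-map\<close>

text \<open>Every vertex of a state diagram has exactly one outgoing arc, so the whole isomorphism
  is determined by the vertex bijection \<open>g\<close>. Here \<open>\<alpha> v\<close> is the arc
  of \<open>H\<close> that leaves \<open>v\<close>, and the condition on heads says that
  \<open>g\<close> carries \<open>f\<close> to the successor map of \<open>H\<close>.\<close>

lemma digraph_iso_state_diagram:
  assumes f: "f ` S \<subseteq> S"
    and g: "bij_betw g S (verts H)"
    and arcs: "arcs H = (\<lambda>a. \<alpha> (g a)) ` S"
    and tail: "\<And>a. a \<in> S \<Longrightarrow> tail H (\<alpha> (g a)) = g a"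
    and head: "\<And>a. a \<in> S \<Longrightarrow> head H (\<alpha> (g a)) = g (f a)"
  shows "digraph_iso (state_diagram f S) H"
proof -
  define hom where "hom = \<lparr>iso_verts = g, iso_arcs = (\<lambda>e :: 'a \<times> 'a. \<alpha> (g (fst e))),
      iso_head = head H, iso_tail = tail H\<rparr>"
  have "wf_digraph (state_diagram f S)"
    using f by (auto simp: wf_digraph_def state_diagram_def)
  moreover have "inj_on g S"
    using g by (rule bij_betw_imp_inj_on)
  moreover have "inj_on (\<lambda>e. \<alpha> (g (fst e))) ((\<lambda>a. (a, f a)) ` S)"
    using \<open>inj_on g S\<close> tail by (auto simp: inj_on_def) metis+
  ultimately have "pre_digraph.digraph_isomorphism (state_diagram f S) hom"
    using tail head
    by (auto simp: pre_digraph.digraph_isomorphism_def state_diagram_def hom_def)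
  moreover have "H = app_iso hom (state_diagram f S)"
    using g arcs
    by (intro pre_digraph.equality)
       (auto simp: app_iso_def state_diagram_def hom_def bij_betw_def image_image)
  ultimately show ?thesis
    unfolding digraph_iso_def by blast
qed

lemma funpow_mod_period:
  assumes per: "(f ^^ c) a = a"
  shows "(f ^^ (k mod c)) a = (f ^^ k) a"
proof -
  have "(f ^^ (c * n)) a = a" for n
    by (induction n) (auto simp: funpow_add per)
  then have "(f ^^ (k mod c + c * (k div c))) a = (f ^^ (k mod c)) a"
    unfolding funpow_add o_apply by simp
  then show ?thesis by simp
qed

text \<open>When all points have exact period \<open>c\<close>, the orbits partition
  \<open>S\<close> into classes of size \<open>c\<close>. Choosing a representative
  \<open>r j\<close> in each orbit gives every point unique coordinates: the number \<open>j\<close>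
  of its orbit and the number \<open>l\<close> of steps from \<open>r j\<close>.\<close>

lemma uniform_period_decomposition:
  assumes "finite S" and f: "f ` S \<subseteq> S" and "c > 0"
    and per: "\<And>a k. a \<in> S \<Longrightarrow> (f ^^ k) a = a \<longleftrightarrow> c dvd k"
  obtains r where
    "bij_betw (\<lambda>(j, l). (f ^^ l) (r j)) ({..<card S div c} \<times> {..<c}) S"
    and "c dvd card S"
proof -
  define orb where "orb = (\<lambda>a. (\<lambda>l. (f ^^ l) a) ` {..<c})"
  have fX: "(f ^^ k) a \<in> S" if "a \<in> S" for a k
    using that f by (induction k) auto
  have eq_iff: "(f ^^ k) a = (f ^^ l) a \<longleftrightarrow> k = l"
    if "a \<in> S" "k < c" "l < c" for a k l
  proof -
    \<comment> \<open>Applying \<open>c - l\<close> further steps to a coincidence would return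
      \<open>a\<close> to itself after \<open>c - l + k\<close> steps, a number strictly between 0
      and \<open>c\<close>.\<close>
    have aux: "(f ^^ k) a \<noteq> (f ^^ l) a" if "k < l" "l < c" for k l
    proof
      assume "(f ^^ k) a = (f ^^ l) a"
      then have "(f ^^ (c - l)) ((f ^^ k) a) = (f ^^ (c - l)) ((f ^^ l) a)" by simp
      then have "(f ^^ (c - l + k)) a = (f ^^ (c - l + l)) a"
        by (simp only: funpow_add o_apply)
      also have "\<dots> = a" using \<open>a \<in> S\<close> \<open>l < c\<close> per[of a c] by simp
      finally have "c dvd c - l + k" using per \<open>a \<in> S\<close> by blast
      then show False using that by (auto dest!: dvd_imp_le)
    qed
    show ?thesis using aux[of k l] aux[of l k] that by (metis linorder_neqE_nat)
  qed
  have card_orb: "card (orb a) = c" if "a \<in> S" for a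
    unfolding orb_def using eq_iff[OF that]
    by (subst card_image) (auto simp: inj_on_def)
  have orb_eq: "orb b = orb a" if a: "a \<in> S" and b: "b \<in> orb a" for a b
  proof -
    obtain l where l: "b = (f ^^ l) a" using b by (auto simp: orb_def)
    have "b \<in> S" using l fX a by simp
    \<comment> \<open>One inclusion suffices, because both orbits have \<open>c\<close>
      elements.\<close>
    have "orb b \<subseteq> orb a"
    proof
      fix y assume "y \<in> orb b"
      then obtain k where "y = (f ^^ (k + l)) a" by (auto simp: orb_def l funpow_add)
      also have "\<dots> = (f ^^ ((k + l) mod c)) a"
        using funpow_mod_period per[OF a] by (metis dvd_refl)
      finally show "y \<in> orb a" using \<open>c > 0\<close> by (auto simp: orb_def)
    qed
    then show ?thesis
      using card_orb a \<open>b \<in> S\<close> by (metis card_subset_eq finite_imageI finite_lessThan orb_def)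
  qed
  have self: "a \<in> orb a" for a
    using \<open>c > 0\<close> by (auto simp: orb_def intro!: image_eqI[of _ _ 0])
  have orb_sub: "orb a \<subseteq> S" if "a \<in> S" for a
    using fX[OF that] by (auto simp: orb_def)
  have Un: "\<Union> (orb ` S) = S"
    using self orb_sub by blast
  have card: "c * card (orb ` S) = card S"
    using card_partition[of "orb ` S" c] \<open>finite S\<close> Un card_orb orb_eq
    by (smt (verit, best) disjoint_iff finite_imageI imageE)
  then have n: "card S div c = card (orb ` S)"
    using \<open>c > 0\<close> by (metis nonzero_mult_div_cancel_left less_numeral_extra(3))
  obtain e where e: "bij_betw e {..<card (orb ` S)} (orb ` S)"
    using ex_bij_betw_nat_finite[of "orb ` S"] \<open>finite S\<close> by (auto simp: atLeast0LessThan)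
  define r where "r = (\<lambda>j. SOME a. a \<in> S \<and> orb a = e j)"
  have r: "r j \<in> S" "orb (r j) = e j" if "j < card (orb ` S)" for j
  proof -
    have "\<exists>a. a \<in> S \<and> orb a = e j"
      using e that by (auto simp: bij_betw_def) (metis (no_types, lifting) imageE imageI lessThan_iff)
    then show "r j \<in> S" "orb (r j) = e j"
      unfolding r_def by (metis (mono_tags, lifting) someI_ex)+
  qed
  have "bij_betw (\<lambda>(j, l). (f ^^ l) (r j)) ({..<card (orb ` S)} \<times> {..<c}) S"
  proof (intro bij_betw_imageI inj_onI; (clarsimp simp: set_eq_iff)?)
    fix j l j' l'
    assume j: "j < card (orb ` S)" "j' < card (orb ` S)" and l: "l < c" "l' < c"
      and eq: "(f ^^ l) (r j) = (f ^^ l') (r j')"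
    have "orb ((f ^^ l) (r j)) = e j"
      using r[OF j(1)] orb_eq[of "r j"] l(1) by (auto simp: orb_def)
    moreover have "orb ((f ^^ l') (r j')) = e j'"
      using r[OF j(2)] orb_eq[of "r j'"] l(2) by (auto simp: orb_def)
    ultimately have "e j = e j'" using eq by simp
    then have "j = j'" using e j by (auto simp: bij_betw_def inj_on_def)
    with eq show "j = j' \<and> l = l'" using eq_iff r(1)[OF j(1)] l by blast
  next
    fix x
    show "x \<in> (\<lambda>(j, l). (f ^^ l) (r j)) ` ({..<card (orb ` S)} \<times> {..<c}) \<longleftrightarrow> x \<in> S"
    proof
      assume "x \<in> (\<lambda>(j, l). (f ^^ l) (r j)) ` ({..<card (orb ` S)} \<times> {..<c})"
      then show "x \<in> S" using fX r(1) by auto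
    next
      assume x: "x \<in> S"
      then obtain j where j: "j < card (orb ` S)" "e j = orb x"
        using e by (auto simp: bij_betw_def) (metis (no_types, lifting) imageE imageI lessThan_iff)
      then have "x \<in> orb (r j)" using self r by simp
      then show "x \<in> (\<lambda>(j, l). (f ^^ l) (r j)) ` ({..<card (orb ` S)} \<times> {..<c})"
        using j by (auto simp: orb_def)
    qed
  qed
  with that card n show ?thesis by (metis dvd_triv_left)
qed

text \<open>The period may vary with \<open>i\<close>, so each \<open>Y i\<close> is decomposed
  separately and the coordinates are glued: \<open>((i, j), l)\<close> stands for the point
  \<open>l\<close> steps after the representative \<open>r i j\<close>. Disjointness of the family
  makes \<open>i\<close> unique.\<close>

lemma digraph_iso_uniform_periods:
  fixes Y :: "'i \<Rightarrow> 'a set" and c :: "'i \<Rightarrow> nat"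
  assumes fin: "\<And>i. i \<in> I \<Longrightarrow> finite (Y i)" and f: "\<And>i. i \<in> I \<Longrightarrow> f ` Y i \<subseteq> Y i"
    and disj: "disjoint_family_on Y I"
    and c: "\<And>i. i \<in> I \<Longrightarrow> c i > 0"
    and per: "\<And>i a k. i \<in> I \<Longrightarrow> a \<in> Y i \<Longrightarrow> (f ^^ k) a = a \<longleftrightarrow> c i dvd k"
  shows "digraph_iso (state_diagram f (\<Union>i\<in>I. Y i))
      (disjoint_union_digraph {(i, j). i \<in> I \<and> j < card (Y i) div c i}
        (\<lambda>(i, j). cycle_digraph (c i)))"
proof -
  define S where "S = (\<Union>i\<in>I. Y i)"
  have "\<exists>r. bij_betw (\<lambda>(j, l). (f ^^ l) (r j)) ({..<card (Y i) div c i} \<times> {..<c i}) (Y i)"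
    if "i \<in> I" for i
    using uniform_period_decomposition[of "Y i" f "c i"] fin[OF that] f[OF that] c[OF that] per[OF that]
    by metis
  then obtain r where r: "bij_betw (\<lambda>(j, l). (f ^^ l) (r i j)) ({..<card (Y i) div c i} \<times> {..<c i}) (Y i)"
    if "i \<in> I" for i
    by metis
  define V where "V = (SIGMA (i, j):{(i, j). i \<in> I \<and> j < card (Y i) div c i}. {..<c i})"
  define h where "h = (\<lambda>((i, j), l). (f ^^ l) (r i j))"
  have hY: "i \<in> I" "h ((i, j), l) \<in> Y i" if "((i, j), l) \<in> V" for i j l
    using r[of i] that by (force simp: bij_betw_def V_def h_def)+
  have h: "bij_betw h V S"
  proof (rule bij_betw_imageI)
    show "inj_on h V"
    proof (rule inj_onI)
      fix x y assume xy: "x \<in> V" "y \<in> V" "h x = h y"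
      obtain i j l i' j' l' where [simp]: "x = ((i, j), l)" "y = ((i', j'), l')"
        by (metis surj_pair)
      have "i = i'" using hY[of i j l] hY[of i' j' l'] xy disj
        by (auto simp: disjoint_family_on_def)
      moreover have "(j, l) = (j', l')"
        using r[of i] xy \<open>i = i'\<close>
        by (intro inj_onD[of "\<lambda>(j, l). (f ^^ l) (r i j)"]) (auto simp: bij_betw_def V_def h_def)
      ultimately show "x = y" by simp
    qed
    show "h ` V = S"
    proof (intro equalityI subsetI)
      fix x assume "x \<in> h ` V" then show "x \<in> S" using hY by (fastforce simp: S_def)
    next
      fix x assume "x \<in> S"
      then obtain i where i: "i \<in> I" "x \<in> Y i" by (auto simp: S_def)
      then have "x \<in> (\<lambda>(j, l). (f ^^ l) (r i j)) ` ({..<card (Y i) div c i} \<times> {..<c i})"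
        using r[OF i(1)] unfolding bij_betw_def by simp
      then obtain j l where "j < card (Y i) div c i" "l < c i" "x = (f ^^ l) (r i j)"
        by (elim imageE) auto
      then show "x \<in> h ` V" using i by (auto simp: V_def h_def intro!: image_eqI[of _ _ "((i, j), l)"])
    qed
  qed
  define H where "H = disjoint_union_digraph {(i, j). i \<in> I \<and> j < card (Y i) div c i}
    (\<lambda>(i, j). cycle_digraph (c i))"
  \<comment> \<open>On the target digraph, \<open>s\<close> is the successor map and
    \<open>\<alpha>\<close> picks the arc leaving a vertex. The map \<open>h\<close> carries
    \<open>s\<close> to \<open>f\<close>; the wrap-around modulo \<open>c i\<close> is harmless
    because \<open>r i j\<close> has period \<open>c i\<close>.\<close>
  define s where "s = (\<lambda>((i :: 'i, j :: nat), l :: nat). ((i, j), Suc l mod c i))"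
  define \<alpha> where "\<alpha> = (\<lambda>((i :: 'i, j :: nat), l :: nat). ((i, j), (l, Suc l mod c i)))"
  have vH: "verts H = V"
    by (auto simp: H_def disjoint_union_digraph_def cycle_digraph_def state_diagram_def V_def)
  have aH: "arcs H = \<alpha> ` V"
    by (auto simp: H_def disjoint_union_digraph_def cycle_digraph_def state_diagram_def V_def \<alpha>_def
        image_iff)
  have tH: "tail H (\<alpha> v) = v" "head H (\<alpha> v) = s v" for v
    by (auto simp: H_def disjoint_union_digraph_def cycle_digraph_def state_diagram_def \<alpha>_def s_def
        split: prod.splits)
  have sV: "s v \<in> V" "h (s v) = f (h v)" if vV: "v \<in> V" for v
  proof -
    obtain i j l where v: "v = ((i, j), l)" by (metis surj_pair)
    have i: "i \<in> I" using vV by (auto simp: v V_def)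
    then show "s v \<in> V" using vV c[of i] by (auto simp: v V_def s_def)
    have "((i, j), 0) \<in> V" using vV c[OF i] by (auto simp: v V_def)
    then have "r i j \<in> Y i" using hY(2)[of i j 0] by (simp add: h_def)
    then have "(f ^^ c i) (r i j) = r i j" using per[OF i] by auto
    then show "h (s v) = f (h v)" using funpow_mod_period[of "c i" f "r i j" "Suc l"]
      by (simp add: v h_def s_def)
  qed
  define g where "g = the_inv_into V h"
  have g: "bij_betw g S V"
    unfolding g_def using h by (rule bij_betw_the_inv_into)
  have gh: "g (h v) = v" if "v \<in> V" for v
    unfolding g_def using h that by (auto simp: bij_betw_def the_inv_into_f_f)
  have S: "S = h ` V" using h by (simp add: bij_betw_def)
  have "digraph_iso (state_diagram f S) H"
  proof (rule digraph_iso_state_diagram[of _ _ g _ \<alpha>])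
    show "f ` S \<subseteq> S" using f by (auto simp: S_def)
    show "bij_betw g S (verts H)" using g vH by simp
    show "arcs H = (\<lambda>a. \<alpha> (g a)) ` S"
      using g by (auto simp: aH bij_betw_def)
    show "tail H (\<alpha> (g a)) = g a" for a by (simp add: tH)
    show "head H (\<alpha> (g a)) = g (f a)" if "a \<in> S" for a
    proof -
      obtain v where v: "v \<in> V" "a = h v" using \<open>a \<in> S\<close> S by blast
      then have "g (f a) = g (h (s v))" using sV by simp
      also have "\<dots> = s v" using sV v by (intro gh) auto
      finally show ?thesis by (simp add: tH v gh)
    qed
  qed
  then show ?thesis
    by (simp add: H_def S_def)
qed

subsection \<open>Roots of unity\<close>

text \<open>The polynomial X^n - 1 splits into linear factors. A multiple root would be a root of
  the derivative n X^(n-1), hence 0 because n is invertible, but 0 is not a root of X^n - 1. So the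
  n roots are distinct.\<close>

lemma card_roots_of_unity:
  assumes "of_nat n \<noteq> (0 :: 'a :: alg_closed_field)"
  shows "card {x :: 'a. x ^ n = 1} = n"
proof -
  define P where "P = Polynomial.monom (1 :: 'a) n - 1"
  have "n > 0" using assms by (cases n) auto
  then have deg: "Polynomial.degree P = n"
    unfolding P_def by (subst diff_conv_add_uminus, subst degree_add_eq_left) (auto simp: Polynomial.degree_monom_eq)
  then have "P \<noteq> 0" using \<open>n > 0\<close> by auto
  have lc: "Polynomial.lead_coeff P = 1"
    unfolding deg using \<open>n > 0\<close> by (simp add: P_def)
  have root: "poly P x = 0 \<longleftrightarrow> x ^ n = 1" for x
    by (simp add: P_def poly_monom)
  obtain A where A: "size A = n" "P = (\<Prod>x\<in>#A. [:-x, 1:])"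
    using alg_closed_imp_factorization[OF \<open>P \<noteq> 0\<close>] lc deg by auto
  have setA: "set_mset A = {x. x ^ n = 1}"
  proof -
    have "poly P x = (\<Prod>y\<in>#A. x - y)" for x
      by (subst A(2)) (simp add: poly_prod_mset image_mset.compositionality o_def)
    then have "x ^ n = 1 \<longleftrightarrow> x \<in># A" for x
      using root[of x] by (auto simp: prod_mset_zero_iff)
    then show ?thesis by blast
  qed
  have "count A z = 1" if z: "z \<in># A" for z
  proof (rule ccontr)
    assume "count A z \<noteq> 1"
    moreover obtain B where B: "A = add_mset z B" using z by (metis multi_member_split)
    ultimately have "z \<in># B" by (auto simp: not_in_iff)
    then obtain C where "B = add_mset z C" by (metis multi_member_split)
    with B A(2) have P: "P = [:-z, 1:] * ([:-z, 1:] * (\<Prod>x\<in>#C. [:-x, 1:]))" by simp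
    have "poly (pderiv P) z = 0" unfolding P pderiv_mult poly_add poly_mult by simp
    moreover have "pderiv P = Polynomial.monom (of_nat n) (n - 1)"
      by (simp add: P_def pderiv_diff pderiv_monom)
    ultimately have "z ^ (n - 1) = 0" using assms by (simp add: poly_monom)
    then have "z = 0" by (metis power_eq_0_iff)
    moreover have "z ^ n = 1" using that setA by auto
    ultimately show False using \<open>n > 0\<close> by (simp add: power_0_left)
  qed
  then have "size A = card (set_mset A)"
    by (simp add: size_multiset_overloaded_eq)
  then show ?thesis using A(1) setA by simp
qed

text \<open>A single divisibility criterion encodes exact order: it determines \<open>d\<close>
  uniquely and is the form used to compute periods. For \<open>d = 0\<close> it describes elements
  of infinite order.\<close>

definition roots_of_order :: "nat \<Rightarrow> 'a::monoid_mult set" where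
  "roots_of_order d = {x. \<forall>k. x ^ k = 1 \<longleftrightarrow> d dvd k}"

lemma roots_of_order_disjoint:
  "x \<in> roots_of_order d \<Longrightarrow> x \<in> roots_of_order e \<Longrightarrow> d = e"
  unfolding roots_of_order_def by (metis (mono_tags, lifting) dvd_antisym dvd_refl mem_Collect_eq)

lemma roots_of_unity_eq_UN_roots_of_order:
  assumes "n > 0"
  shows "{x :: 'a::monoid_mult. x ^ n = 1} = (\<Union>d\<in>{d. d dvd n}. roots_of_order d)"
proof (intro equalityI subsetI)
  fix x :: 'a assume "x \<in> {x. x ^ n = 1}"
  then have x: "x ^ n = 1" by simp
  define d where "d = (LEAST k. k > 0 \<and> x ^ k = 1)"
  have d: "d > 0" "x ^ d = 1"
    unfolding d_def using LeastI[of "\<lambda>k. k > 0 \<and> x ^ k = 1" n] assms x by auto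
  have "x ^ k = 1 \<longleftrightarrow> d dvd k" for k
  proof
    assume k: "x ^ k = 1"
    have "x ^ (d * (k div d) + k mod d) = 1" using k by simp
    then have "x ^ (k mod d) = 1" unfolding power_add power_mult using d by simp
    moreover have "k mod d < d" using d by simp
    ultimately have "k mod d = 0"
      unfolding d_def by (metis (mono_tags, lifting) bot_nat_0.not_eq_extremum not_less_Least)
    then show "d dvd k" by auto
  qed (use d in \<open>auto simp: power_mult elim!: dvdE\<close>)
  then show "x \<in> (\<Union>d\<in>{d. d dvd n}. roots_of_order d)"
    using x by (auto simp: roots_of_order_def)
qed (auto simp: roots_of_order_def)

text \<open>Sorting the n-th roots of unity by order writes n as a sum over the divisors of n, and
  the totients satisfy the same identity. By induction all terms for proper divisors agree, so the
  terms for n agree as well.\<close>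

lemma card_roots_of_order:
  assumes "of_nat n \<noteq> (0 :: 'a :: alg_closed_field)"
  shows "card (roots_of_order n :: 'a set) = totient n"
  using assms
proof (induction n rule: less_induct)
  case (less n)
  have "n > 0" using less.prems by (cases n) auto
  then have fin: "finite {d. d dvd n}" by simp
  have finU: "finite {x :: 'a. x ^ n = 1}"
    using card_roots_of_unity[OF less.prems] \<open>n > 0\<close> card.infinite by fastforce
  have "n = card {x :: 'a. x ^ n = 1}"
    using card_roots_of_unity[OF less.prems] by simp
  also have "\<dots> = (\<Sum>d | d dvd n. card (roots_of_order d :: 'a set))"
    unfolding roots_of_unity_eq_UN_roots_of_order[OF \<open>n > 0\<close>]
  proof (rule card_UN_disjoint[OF fin])
    show "\<forall>d\<in>{d. d dvd n}. finite (roots_of_order d :: 'a set)"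
      using finU unfolding roots_of_unity_eq_UN_roots_of_order[OF \<open>n > 0\<close>]
      by (auto intro: rev_finite_subset)
    show "\<forall>d\<in>{d. d dvd n}. \<forall>e\<in>{d. d dvd n}. d \<noteq> e \<longrightarrow>
        roots_of_order d \<inter> roots_of_order e = ({} :: 'a set)"
      using roots_of_order_disjoint by blast
  qed
  also have "\<dots> = card (roots_of_order n :: 'a set)
      + (\<Sum>d \<in> {d. d dvd n} - {n}. card (roots_of_order d :: 'a set))"
    using fin by (subst sum.remove[of _ n]) auto
  also have "(\<Sum>d \<in> {d. d dvd n} - {n}. card (roots_of_order d :: 'a set))
      = (\<Sum>d \<in> {d. d dvd n} - {n}. totient d)"
  proof (rule sum.cong)
    fix d assume d: "d \<in> {d. d dvd n} - {n}"
    then have "of_nat d \<noteq> (0 :: 'a)" using less.prems by (auto elim!: dvdE)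
    moreover have "d < n" using d \<open>n > 0\<close> by (auto dest: dvd_imp_le)
    ultimately show "card (roots_of_order d :: 'a set) = totient d" by (rule less.IH[rotated])
  qed simp
  finally have "n = card (roots_of_order n :: 'a set) + (\<Sum>d \<in> {d. d dvd n} - {n}. totient d)" .
  moreover have "n = totient n + (\<Sum>d \<in> {d. d dvd n} - {n}. totient d)"
    using fin totient_divisor_sum[of n] by (subst (asm) sum.remove[of _ n]) auto
  ultimately show ?case by linarith
qed

text \<open>The residues 1 and -1 form a group, so multiplying by one of them does not change
  whether a residue belongs to it. The exponents of 2 that land in this group are therefore the
  multiples of the least positive one.\<close>

lemma ord2'_pos_and_dvd_iff:
  assumes "odd d"
  shows "ord2' d > 0"
    and "ord2' d dvd k \<longleftrightarrow> [(2::int) ^ k = 1] (mod int d) \<or> [(2::int) ^ k = - 1] (mod int d)"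
proof -
  define pm where "pm x \<longleftrightarrow> [x = 1] (mod int d) \<or> [x = - 1] (mod int d)" for x
  define c where "c = ord2' d"
  have pm_mult: "pm (x * y) \<longleftrightarrow> pm y" if x: "pm x" for x y
  proof -
    consider "[x * y = y] (mod int d)" | "[x * y = - y] (mod int d)"
      using x cong_mult[of x 1 "int d" y y] cong_mult[of x "-1" "int d" y y] by (auto simp: pm_def)
    then show ?thesis
    proof cases
      case 1 then show ?thesis unfolding pm_def by (meson cong_sym cong_trans)
    next
      case 2
      then have "pm (x * y) \<longleftrightarrow> pm (- y)" unfolding pm_def by (meson cong_sym cong_trans)
      also have "\<dots> \<longleftrightarrow> pm y" unfolding pm_def
        using cong_minus_minus_iff[of y 1] cong_minus_minus_iff[of y "-1"] by auto
      finally show ?thesis .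
    qed
  qed
  \<comment> \<open>Euler's theorem supplies a positive exponent, so the \<open>LEAST\<close> in
    \<open>ord2'\<close> is attained.\<close>
  have "coprime 2 d" using assms by simp
  then have "[2 ^ totient d = 1] (mod d)" by (rule euler_theorem)
  then have "[int (2 ^ totient d) = int 1] (mod int d)" by (simp only: cong_int_iff)
  then have ex: "totient d > 0 \<and> pm (2 ^ totient d)"
    using assms by (auto simp: pm_def intro: Nat.gr0I)
  have c: "c > 0 \<and> pm (2 ^ c)"
    unfolding c_def ord2'_def using LeastI[of "\<lambda>k. k > 0 \<and> pm (2 ^ k)", OF ex] by (simp add: pm_def)
  then show "ord2' d > 0" by (simp add: c_def)
  have mult: "pm (2 ^ (c * q + r)) \<longleftrightarrow> pm (2 ^ r)" for q r
  proof (induction q)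
    case (Suc q)
    have "(2::int) ^ (c * Suc q + r) = 2 ^ c * 2 ^ (c * q + r)" by (simp add: power_add)
    then show ?case using Suc pm_mult c by metis
  qed simp
  have "c dvd k \<longleftrightarrow> pm (2 ^ k)"
  proof
    assume "c dvd k"
    then obtain q where "k = c * q + 0" by (auto elim: dvdE)
    then show "pm (2 ^ k)" using mult[of q 0] by (simp add: pm_def)
  next
    assume "pm (2 ^ k)"
    then have "pm (2 ^ (k mod c))" using mult[of "k div c" "k mod c"] by simp
    moreover have "k mod c < (LEAST k. k > 0 \<and> pm (2 ^ k))"
      using c by (simp add: c_def ord2'_def pm_def)
    ultimately have "\<not> k mod c > 0"
      using not_less_Least[of "k mod c" "\<lambda>k. k > 0 \<and> pm (2 ^ k)"] by simp
    then show "c dvd k" by auto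
  qed
  then show "ord2' d dvd k \<longleftrightarrow> [(2::int) ^ k = 1] (mod int d) \<or> [(2::int) ^ k = - 1] (mod int d)"
    by (simp add: pm_def c_def)
qed

section \<open>The Frobenius map of a finite field and its fixed points in the algebraic
  closure\<close>

lemma power_card_eq_same:
  fixes x :: "'a::{field,finite}"
  shows "x ^ CARD('a) = x"
proof (cases "x = 0")
  case False
  \<comment> \<open>Multiplication by \<open>x\<close> permutes the nonzero elements, so it
    preserves their product.\<close>
  have "x ^ (CARD('a) - 1) * \<Prod>(UNIV - {0}) = (\<Prod>y\<in>UNIV - {0}. x * y)"
    by (simp add: prod.distrib)
  also have "\<dots> = \<Prod>(UNIV - {0})"
    by (rule prod.reindex_bij_witness[of _ "\<lambda>y. y / x" "\<lambda>y. x * y"]) (use False in auto)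
  finally have "x ^ (CARD('a) - 1) = 1" by simp
  then have "x ^ Suc (CARD('a) - 1) = x" unfolding power_Suc by simp
  moreover have "CARD('a) > 0" by simp
  ultimately show ?thesis by (metis Suc_pred')
qed simp

text \<open>With q = \<open>CARD('a)\<close>, the polynomial X^q - X has at most q roots, and the q
  embedded elements of the base field are already roots. This turns membership in the base field
  into a computation with q-th powers.\<close>

lemma power_card_eq_same_iff_in_range_to_ac:
  fixes z :: "'a::{field,finite} alg_closure"
  assumes "CARD('a) > 1"
  shows "z ^ CARD('a) = z \<longleftrightarrow> z \<in> range to_ac"
proof -
  define P where "P = Polynomial.monom (1 :: 'a alg_closure) CARD('a) - [:0, 1:]"
  have "Polynomial.degree P = CARD('a)"
    unfolding P_def using assms
    by (subst diff_conv_add_uminus, subst degree_add_eq_left) (auto simp: Polynomial.degree_monom_eq)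
  moreover from this have "P \<noteq> 0" using assms by auto
  ultimately have le: "card {z. poly P z = 0} \<le> CARD('a)" and fin: "finite {z. poly P z = 0}"
    using card_poly_roots_bound poly_roots_finite by fastforce+
  have root: "poly P z = 0 \<longleftrightarrow> z ^ CARD('a) = z" for z
    by (simp add: P_def poly_monom)
  have "range to_ac \<subseteq> {z. poly P z = 0}"
    using power_card_eq_same by (auto simp: root simp flip: to_ac_power)
  moreover have "card (range (to_ac :: 'a \<Rightarrow> _)) = CARD('a)"
    using inj_to_ac by (rule card_image)
  ultimately have "range to_ac = {z. poly P z = 0}"
    using le fin by (metis card_seteq)
  then show ?thesis using root by auto
qed

subsection \<open>Conjugation of the map to squaring\<close>

text \<open>For \<open>x \<noteq> 0\<close> this is the Zhukovsky map shifted by a constant, \<open>(x + 1/x - 2) / 4\<close>.\<close>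

definition zh :: "'a::field \<Rightarrow> 'a" where
  "zh x = (x - 1)\<^sup>2 / (4 * x)"

text \<open>Since \<open>zh x + 1 = (x + 1)\<^sup>2 / (4 * x)\<close>, the product on the right has
  numerator \<open>(x - 1)\<^sup>2 * (x + 1)\<^sup>2 = (x\<^sup>2 - 1)\<^sup>2\<close>.\<close>

lemma zh_square:
  fixes x :: "'a::field"
  assumes "(2::'a) \<noteq> 0" "x \<noteq> 0"
  shows "zh (x\<^sup>2) = 4 * zh x * (zh x + 1)"
proof -
  have four: "(4::'a) \<noteq> 0" using assms(1) by (metis mult_eq_0_iff mult_2 numeral_Bit0)
  then have "zh x + 1 = (x + 1)\<^sup>2 / (4 * x)"
    using assms(2) by (simp add: zh_def field_simps power2_eq_square)
  moreover have "c * (u / (c * x)) * (v / (c * x)) = u * v / (c * x\<^sup>2)" if "c \<noteq> 0" for c u v :: 'a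
    using that assms(2) by (simp add: field_simps power2_eq_square)
  moreover have "(x - 1)\<^sup>2 * (x + 1)\<^sup>2 = (x\<^sup>2 - 1)\<^sup>2"
    by (simp add: algebra_simps power2_eq_square)
  ultimately show ?thesis
    using four by (simp add: zh_def power2_eq_square[of x])
qed

text \<open>Clearing denominators, the difference of the two sides factors as
  \<open>(x - y) * (x * y - 1)\<close>.\<close>

lemma zh_eq_iff:
  fixes x y :: "'a::field"
  assumes "(2::'a) \<noteq> 0" "x \<noteq> 0" "y \<noteq> 0"
  shows "zh x = zh y \<longleftrightarrow> x = y \<or> x * y = 1"
proof -
  have "(4::'a) \<noteq> 0" using assms(1) by (metis mult_eq_0_iff mult_2 numeral_Bit0)
  then have "zh x = zh y \<longleftrightarrow> (x - 1)\<^sup>2 * y = (y - 1)\<^sup>2 * x"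
    using assms by (simp add: zh_def field_simps)
  also have "\<dots> \<longleftrightarrow> (x - y) * (x * y - 1) = 0"
    by (simp add: algebra_simps power2_eq_square)
  also have "\<dots> \<longleftrightarrow> x = y \<or> x * y = 1" by simp
  finally show ?thesis .
qed

lemma inverse_in_roots_of_order:
  fixes x :: "'a::field"
  shows "x \<in> roots_of_order d \<Longrightarrow> inverse x \<in> roots_of_order d"
  by (simp add: roots_of_order_def power_inverse)

text \<open>The fibres of \<open>zh\<close> on the roots of order \<open>d\<close> are the pairs of
  mutually inverse roots. No root is its own inverse, as its order would then divide 2, while
  \<open>d\<close> is odd and different from 1.\<close>

lemma card_zh_image_roots_of_order:
  fixes d :: nat
  assumes two: "(2::'a::alg_closed_field) \<noteq> 0" and d: "of_nat d \<noteq> (0::'a)" "odd d" "d \<noteq> 1"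
  shows "2 * card (zh ` (roots_of_order d :: 'a set)) = totient d"
proof -
  let ?R = "roots_of_order d :: 'a set"
  have pow: "x ^ k = 1 \<longleftrightarrow> d dvd k" if "x \<in> ?R" for x k
    using that by (simp add: roots_of_order_def)
  have "d > 0" using d by (cases d) auto
  have nz: "x \<noteq> 0" if "x \<in> ?R" for x
    using pow[OF that, of d] \<open>d > 0\<close> by (auto simp: power_0_left)
  have fin: "finite ?R"
    using card_roots_of_order[OF d(1)] \<open>d > 0\<close> by (metis card.infinite totient_gt_0_iff less_irrefl)
  have fib: "card {x \<in> ?R. zh x = b} = 2" if b: "b \<in> zh ` ?R" for b
  proof -
    obtain x where x: "x \<in> ?R" "b = zh x" using b by auto
    have "{y \<in> ?R. zh y = b} = {x, inverse x}"
    proof (intro equalityI subsetI)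
      fix y assume "y \<in> {y \<in> ?R. zh y = b}"
      then have y: "y \<in> ?R" "zh y = zh x" using x by auto
      then have "y = x \<or> y * x = 1" using zh_eq_iff[OF two] nz x by auto
      then show "y \<in> {x, inverse x}" using inverse_unique[of y x] by (auto simp: mult.commute inverse_unique)
    next
      fix y assume "y \<in> {x, inverse x}"
      then show "y \<in> {y \<in> ?R. zh y = b}" using x inverse_in_roots_of_order nz[OF x(1)] zh_eq_iff[OF two, of "inverse x" x] by auto
    qed
    moreover have "x \<noteq> inverse x"
    proof
      assume "x = inverse x"
      then have "x ^ 2 = 1" using nz[OF x(1)] by (metis power2_eq_square right_inverse)
      then have "d dvd 2" using pow x by blast
      then have "d \<le> 2" by (auto dest: dvd_imp_le)
      then show False using d \<open>d > 0\<close> by (cases "d = 2") auto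
    qed
    ultimately show ?thesis by simp
  qed
  have "totient d = (\<Sum>x\<in>?R. 1)" using card_roots_of_order[OF d(1)] by simp
  also have "\<dots> = (\<Sum>b\<in>zh ` ?R. \<Sum>x\<in>{x \<in> ?R. zh x = b}. 1)"
    by (rule sum.image_gen[OF fin])
  also have "\<dots> = (\<Sum>b\<in>zh ` ?R. 2)"
    using fib by (intro sum.cong) auto
  finally show ?thesis by simp
qed

text \<open>Both residue classes of p modulo 4 lead to the same hypothesis on \<open>S\<close>, so
  the cycle structure is computed once. The set is split by the order \<open>d\<close> of the root
  of unity, and on each piece the period is constant.\<close>

lemma state_diagram_zh_image:
  fixes S :: "'a::{field,finite} set"
  assumes two: "(2::'a) \<noteq> 0" and m: "of_nat m \<noteq> (0::'a)" "odd m"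
    and S: "to_ac ` S = zh ` ({x. x ^ m = 1} - {1})"
  shows "digraph_iso (state_diagram (\<lambda>a. 4 * a * (a + 1)) S) (cycle_union m)"
    and "d dvd m \<Longrightarrow> d \<noteq> 1 \<Longrightarrow> 2 * ord2' d dvd totient d"
proof -
  let ?R = "\<lambda>d. roots_of_order d :: 'a alg_closure set"
  define f where "f = (\<lambda>a::'a. 4 * a * (a + 1))"
  define I where "I = {d. d dvd m \<and> d \<noteq> 1}"
  define Y where "Y d = {a :: 'a. to_ac a \<in> zh ` ?R d}" for d
  have two': "(2::'a alg_closure) \<noteq> 0" using two by (metis to_ac_eq_0_iff to_ac_numeral)
  have "m > 0" using m(2) by (auto intro: Nat.gr0I)
  have I: "odd d" "d > 0" "of_nat d \<noteq> (0::'a alg_closure)" "d \<noteq> 1" if "d \<in> I" for d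
  proof -
    have "of_nat m \<noteq> (0::'a alg_closure)" using m(1) by (metis to_ac_eq_0_iff to_ac_of_nat)
    then show "odd d" "d > 0" "of_nat d \<noteq> (0::'a alg_closure)" "d \<noteq> 1"
      using m(2) \<open>m > 0\<close> that by (auto simp: I_def elim!: dvdE)
  qed
  have pow: "x ^ k = 1 \<longleftrightarrow> d dvd k" if "x \<in> ?R d" for x d k
    using that by (simp add: roots_of_order_def)
  have nz: "x \<noteq> 0" if "x \<in> ?R d" "d \<in> I" for x d
    using pow[OF that(1), of d] I(2)[OF that(2)] by (auto simp: power_0_left)
  have "{x. x ^ m = 1} - {1} = (\<Union>d\<in>I. ?R d)"
  proof -
    have "x \<in> ?R d \<Longrightarrow> x = 1 \<longleftrightarrow> d = 1" for x d
      using pow[of x d 1] by simp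
    then show ?thesis
      unfolding roots_of_unity_eq_UN_roots_of_order[OF \<open>m > 0\<close>] I_def by blast
  qed
  then have SR: "to_ac ` S = (\<Union>d\<in>I. zh ` ?R d)" using S by auto
  have SY: "S = (\<Union>d\<in>I. Y d)"
  proof (intro equalityI subsetI)
    fix a assume "a \<in> S"
    then have "to_ac a \<in> (\<Union>d\<in>I. zh ` ?R d)" using SR by blast
    then show "a \<in> (\<Union>d\<in>I. Y d)" by (auto simp: Y_def)
  next
    fix a assume "a \<in> (\<Union>d\<in>I. Y d)"
    then have "to_ac a \<in> to_ac ` S" unfolding SR by (auto simp: Y_def)
    then show "a \<in> S" by auto
  qed
  \<comment> \<open>\<open>Y d\<close> is only a preimage. That it loses nothing rests on the
    hypothesis on \<open>S\<close>, which places all these values of \<open>zh\<close> in the base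
    field.\<close>
  have toY: "to_ac ` Y d = zh ` ?R d" if "d \<in> I" for d
  proof -
    have "zh ` ?R d \<subseteq> range to_ac" using SR that by blast
    moreover have "to_ac ` Y d = range to_ac \<inter> zh ` ?R d" by (auto simp: Y_def)
    ultimately show ?thesis by (simp add: inf.absorb2)
  qed
  have cardY: "2 * card (Y d) = totient d" if "d \<in> I" for d
  proof -
    have "card (to_ac ` Y d) = card (Y d)"
      by (rule card_image) (auto simp: inj_on_def)
    then show ?thesis
      using card_zh_image_roots_of_order[OF two', of d] I[OF that] toY[OF that] by simp
  qed
  have step: "to_ac (f a) = zh (x\<^sup>2)" if "to_ac a = zh x" "x \<noteq> 0" for a x
    using that zh_square[OF two' that(2)] by (simp add: f_def)
  have iter: "to_ac ((f ^^ k) a) = zh (x ^ (2 ^ k))" if "to_ac a = zh x" "x \<noteq> 0" for a x k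
  proof (induction k)
    case (Suc k)
    then have "to_ac (f ((f ^^ k) a)) = zh ((x ^ (2 ^ k))\<^sup>2)"
      using that by (intro step) auto
    then show ?case by (simp add: power_mult[symmetric] mult.commute)
  qed (use that in simp)
  have fY: "f ` Y d \<subseteq> Y d" if d: "d \<in> I" for d
  proof
    fix b assume "b \<in> f ` Y d"
    then obtain a x where ax: "b = f a" "to_ac a = zh x" "x \<in> ?R d" by (auto simp: Y_def)
    \<comment> \<open>Squaring preserves an odd order: \<open>d\<close> divides \<open>2 * k\<close>
      only if it divides \<open>k\<close>.\<close>
    have "x\<^sup>2 \<in> ?R d"
      using I(1)[OF d] ax(3) by (auto simp: roots_of_order_def power_mult[symmetric]
          coprime_dvd_mult_right_iff)
    then show "b \<in> Y d" using step ax nz[OF ax(3) d] by (auto simp: Y_def)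
  qed
  have per: "(f ^^ k) a = a \<longleftrightarrow> ord2' d dvd k" if d: "d \<in> I" and a: "a \<in> Y d" for d a k
  proof -
    obtain x where x: "to_ac a = zh x" "x \<in> ?R d" using a by (auto simp: Y_def)
    have x0: "x \<noteq> 0" using nz x d by blast
    have "(f ^^ k) a = a \<longleftrightarrow> to_ac ((f ^^ k) a) = to_ac a" by simp
    also have "\<dots> \<longleftrightarrow> zh (x ^ (2 ^ k)) = zh x" using iter[OF x(1) x0] x by simp
    also have "\<dots> \<longleftrightarrow> x ^ (2 ^ k) = x \<or> x ^ (2 ^ k) * x = 1"
      using zh_eq_iff[OF two'] x0 by simp
    also have "x ^ (2 ^ k) = x \<longleftrightarrow> x ^ (2 ^ k - 1) = 1"
    proof -
      have "x ^ (2 ^ k) = x ^ (2 ^ k - 1) * x"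
        by (metis power_minus_mult zero_less_numeral zero_less_power)
      then show ?thesis using x0 by simp
    qed
    also have "x ^ (2 ^ k - 1) = 1 \<longleftrightarrow> [(2::int) ^ k = 1] (mod int d)"
    proof -
      \<comment> \<open>The subtraction inside \<open>int\<close> is the truncated one; it is exact
        because \<open>2 ^ k\<close> is at least 1.\<close>
      have "int (2 ^ k - 1) = 2 ^ k - 1" by (simp add: of_nat_diff)
      then have "d dvd 2 ^ k - 1 \<longleftrightarrow> int d dvd 2 ^ k - 1"
        by (metis int_dvd_int_iff)
      then show ?thesis using pow[OF x(2)] by (simp add: cong_iff_dvd_diff)
    qed
    also have "x ^ (2 ^ k) * x = 1 \<longleftrightarrow> [(2::int) ^ k = - 1] (mod int d)"
    proof -
      have "x ^ (2 ^ k) * x = 1 \<longleftrightarrow> d dvd 2 ^ k + 1"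
        using pow[OF x(2), of "2 ^ k + 1"] by (simp add: mult.commute)
      moreover have "int (2 ^ k + 1) = 2 ^ k + 1" by simp
      then have "d dvd 2 ^ k + 1 \<longleftrightarrow> int d dvd 2 ^ k + 1"
        by (metis int_dvd_int_iff)
      ultimately show ?thesis by (simp add: cong_iff_dvd_diff)
    qed
    also have "[(2::int) ^ k = 1] (mod int d) \<or> [(2::int) ^ k = - 1] (mod int d) \<longleftrightarrow> ord2' d dvd k"
      using ord2'_pos_and_dvd_iff(2)[OF I(1)[OF d]] by simp
    finally show ?thesis .
  qed
  have disj: "disjoint_family_on Y I"
    unfolding disjoint_family_on_def
  proof (intro ballI impI)
    fix d e assume de: "d \<in> I" "e \<in> I" "d \<noteq> e"
    show "Y d \<inter> Y e = {}"
    proof (rule ccontr)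
      assume "Y d \<inter> Y e \<noteq> {}"
      then obtain a where "to_ac a \<in> zh ` ?R d" "to_ac a \<in> zh ` ?R e" by (auto simp: Y_def)
      then obtain x y where xy: "x \<in> ?R d" "y \<in> ?R e" "zh x = zh y" by (metis imageE)
      \<comment> \<open>A common value of \<open>zh\<close> forces equal or inverse roots, and
        inversion preserves the order.\<close>
      then have "x = y \<or> x * y = 1" using zh_eq_iff[OF two'] nz de by blast
      then have "x = y \<or> x = inverse y" by (metis inverse_unique mult.commute)
      then have "x \<in> ?R e" using xy(2) inverse_in_roots_of_order by blast
      then show False using roots_of_order_disjoint xy(1) de by blast
    qed
  qed
  have pos: "ord2' d > 0" if "d \<in> I" for d
    using ord2'_pos_and_dvd_iff(1) I(1)[OF that] by blast
  have dvd: "ord2' d dvd card (Y d)" if d: "d \<in> I" for d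
    using uniform_period_decomposition[of "Y d" f "ord2' d"] fY[OF d] pos[OF d] per[OF d]
    by (metis finite)
  show "2 * ord2' d dvd totient d" if "d dvd m" "d \<noteq> 1" for d
    using dvd[of d] cardY[of d] that by (metis (mono_tags, lifting) I_def mem_Collect_eq
        dvd_refl mult_dvd_mono)
  have count: "cycle_count d = card (Y d) div ord2' d" if "d \<in> I" for d
    using cardY[OF that] by (simp add: cycle_count_def flip: cardY[OF that])
  have "digraph_iso (state_diagram f (\<Union>d\<in>I. Y d))
      (disjoint_union_digraph {(d, j). d \<in> I \<and> j < card (Y d) div ord2' d}
        (\<lambda>(d, j). cycle_digraph (ord2' d)))"
    using fY disj pos per by (intro digraph_iso_uniform_periods) auto
  moreover have "{(d, j). d \<in> I \<and> j < card (Y d) div ord2' d}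
      = {(d, j). d dvd m \<and> d \<noteq> 1 \<and> j < cycle_count d}"
    using count by (auto simp: I_def)
  ultimately show "digraph_iso (state_diagram (\<lambda>a. 4 * a * (a + 1)) S) (cycle_union m)"
    by (simp add: cycle_union_def cycle_length_def SY f_def)
qed

subsection \<open>Squares and the Frobenius map\<close>

lemma mem_squares_iff:
  fixes a :: "'a::field"
  shows "a \<in> D\<^sub>0 \<longleftrightarrow> a \<noteq> 0 \<and> (\<exists>r. a = r\<^sup>2)"
    and "a \<in> D\<^sub>1 \<longleftrightarrow> (\<nexists>r. a = r\<^sup>2)"
    and "a \<in> D\<^sub>0 \<ominus> 1 \<longleftrightarrow> a + 1 \<noteq> 0 \<and> (\<exists>r. a + 1 = r\<^sup>2)"
  by (simp_all add: translate_def nonzero_squares_def nonsquares_def is_nth_power_def)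

lemma CHAR_eq_prime_CARD:
  assumes "prime CARD('a::{field,finite})"
  shows "CHAR('a) = CARD('a)"
proof -
  have "CHAR('a) = 1 \<or> CHAR('a) = CARD('a)"
    using CHAR_dvd_CARD[where 'a = 'a] assms by (auto simp: prime_nat_iff)
  then show ?thesis by simp
qed

text \<open>The half difference and half sum of \<open>y\<close> and its inverse behave like sinh
  and cosh: their squares differ by \<open>y * inverse y = 1\<close>. Whether they lie in the base
  field decides which of \<open>a\<close> and \<open>a + 1\<close> are squares.\<close>

lemma zh_eq_square_half_difference:
  fixes y :: "'a::field"
  assumes "(2::'a) \<noteq> 0" "y \<noteq> 0"
  shows "zh (y\<^sup>2) = ((y - inverse y) / 2)\<^sup>2" and "zh (y\<^sup>2) + 1 = ((y + inverse y) / 2)\<^sup>2"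
proof -
  have four: "(4::'a) \<noteq> 0" using assms(1) by (metis mult_eq_0_iff mult_2 numeral_Bit0)
  have eq: "(y - inverse y) / 2 = (y\<^sup>2 - 1) / (2 * y)"
    using assms by (simp add: field_simps power2_eq_square)
  show *: "zh (y\<^sup>2) = ((y - inverse y) / 2)\<^sup>2"
    unfolding eq by (simp add: zh_def power_divide power_mult_distrib)
  have "((y + inverse y) / 2)\<^sup>2 = ((y - inverse y) / 2)\<^sup>2 + y * inverse y"
    using four by (simp add: power_divide field_simps power2_eq_square)
  then show "zh (y\<^sup>2) + 1 = ((y + inverse y) / 2)\<^sup>2" using * assms by simp
qed

text \<open>Here \<open>y = R + S\<close> is recovered from its half sum \<open>R\<close> and half
  difference \<open>S\<close>: the hypothesis says \<open>(R + S) * (R - S) = 1\<close>.\<close>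

lemma zh_square_of_sum:
  fixes R S :: "'a::field"
  assumes "(2::'a) \<noteq> 0" "R\<^sup>2 = S\<^sup>2 + 1"
  shows "R + S \<noteq> 0" and "inverse (R + S) = R - S" and "zh ((R + S)\<^sup>2) = S\<^sup>2"
proof -
  have 1: "(R + S) * (R - S) = 1"
    using assms(2) by (simp add: algebra_simps power2_eq_square)
  then show nz: "R + S \<noteq> 0" by auto
  show inv: "inverse (R + S) = R - S"
    using 1 by (rule inverse_unique)
  show "zh ((R + S)\<^sup>2) = S\<^sup>2"
    unfolding zh_eq_square_half_difference(1)[OF assms(1) nz] inv using assms(1) by simp
qed

text \<open>For odd \<open>m\<close>, \<open>(m + 1) div 2\<close> inverts 2 modulo
  \<open>m\<close>, so this power of \<open>x\<close> is a square root of \<open>x\<close> that is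
  again an m-th root of unity. If \<open>y\<close> equals its inverse then \<open>x = 1\<close>; if
  it equals minus its inverse then \<open>x = -1\<close>, impossible for odd
  \<open>m\<close>.\<close>

lemma root_of_unity_odd_order:
  fixes x :: "'a::field"
  assumes "(2::'a) \<noteq> 0" "odd m" "x ^ m = 1"
  obtains y where "x = y\<^sup>2" "y ^ m = 1" "y \<noteq> 0"
    and "x \<noteq> 1 \<Longrightarrow> y - inverse y \<noteq> 0" and "y + inverse y \<noteq> 0"
proof
  define y where "y = x ^ ((m + 1) div 2)"
  have "y\<^sup>2 = x ^ ((m + 1) div 2 * 2)" by (simp add: y_def power_mult)
  also have "(m + 1) div 2 * 2 = Suc m" using assms(2) by presburger
  finally show x: "x = y\<^sup>2" using assms(3) by simp
  show ym: "y ^ m = 1" by (metis assms(3) power_mult mult.commute power_one y_def)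
  have "m > 0" using assms(2) by (auto intro: Nat.gr0I)
  then show y0: "y \<noteq> 0" using ym by (auto simp: power_0_left)
  show "y - inverse y \<noteq> 0" if "x \<noteq> 1"
    using that x right_inverse[OF y0] by (auto simp: power2_eq_square)
  show "y + inverse y \<noteq> 0"
  proof
    assume "y + inverse y = 0"
    then have "y * (y + inverse y) = 0" by simp
    then have "x + 1 = 0" using y0 by (simp add: x algebra_simps power2_eq_square)
    then have "x = - 1" by (simp add: eq_neg_iff_add_eq_0)
    then have "(-1 :: 'a) = 1" using assms by simp
    then show False using assms(1) by (metis one_add_one add_eq_0_iff)
  qed
qed

text \<open>If \<open>a = s\<^sup>2\<close> and \<open>a + 1 = r\<^sup>2\<close>, then
  \<open>r + s\<close> is a nonzero element of the base field, so its square is an m-th root of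
  unity. Conversely, \<open>y ^ m = 1\<close> makes the Frobenius map fix \<open>y\<close>, which
  puts \<open>y\<close> and both square roots in the base field.\<close>

lemma to_ac_image_squares_case_3_mod_4:
  assumes two: "(2::'a::{field,finite}) \<noteq> 0" and m: "odd m" "CARD('a) = 2 * m + 1"
  shows "to_ac ` (D\<^sub>0 \<inter> (D\<^sub>0 \<ominus> 1) :: 'a set) = zh ` ({x. x ^ m = 1} - {1})"
proof (intro equalityI subsetI)
  have two': "(2::'a alg_closure) \<noteq> 0" using two by (metis to_ac_eq_0_iff to_ac_numeral)
  have "m > 0" using m(1) by (auto intro: Nat.gr0I)
  fix b :: "'a alg_closure"
  {
    assume "b \<in> to_ac ` (D\<^sub>0 \<inter> (D\<^sub>0 \<ominus> 1) :: 'a set)"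
    then obtain a :: 'a where a: "b = to_ac a" "a \<in> D\<^sub>0" "a \<in> D\<^sub>0 \<ominus> 1" by blast
    from a(2) obtain s where s: "a = s\<^sup>2" "s \<noteq> 0" by (auto simp: mem_squares_iff(1))
    from a(3) obtain r where "a + 1 = r\<^sup>2" by (auto simp: mem_squares_iff(3))
    then have b: "b = to_ac (s\<^sup>2)" and rs: "r\<^sup>2 = s\<^sup>2 + 1" "s \<noteq> 0"
      using a(1) s by simp_all
    define x where "x = to_ac ((r + s)\<^sup>2)"
    have "(r + s) ^ (2 * m) * (r + s) = 1 * (r + s)"
      using power_card_eq_same[of "r + s"] m(2) by (simp add: mult.commute)
    then have "(r + s) ^ (2 * m) = 1"
      using zh_square_of_sum(1)[OF two rs(1)] by (subst (asm) mult_right_cancel) auto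
    then have "x ^ m = 1" unfolding x_def by (simp flip: to_ac_power power_mult)
    moreover have zx: "zh x = b"
      using zh_square_of_sum(3)[OF two', of "to_ac r" "to_ac s"] rs(1)
      by (simp add: x_def b flip: to_ac_power to_ac_add to_ac_1)
    \<comment> \<open>The excluded root 1 corresponds to the value 0 of \<open>zh\<close>, whereas
      \<open>s\<close> is nonzero.\<close>
    moreover have "x \<noteq> 1" using zx rs(2) by (auto simp: b zh_def)
    ultimately show "b \<in> zh ` ({x. x ^ m = 1} - {1})" by blast
  next
    assume "b \<in> zh ` ({x. x ^ m = 1} - {1})"
    then obtain x where x: "x ^ m = 1" "x \<noteq> 1" "b = zh x" by blast
    obtain y where y: "x = y\<^sup>2" "y ^ m = 1" "y \<noteq> 0" "y - inverse y \<noteq> 0" "y + inverse y \<noteq> 0"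
      using root_of_unity_odd_order[OF two' m(1) x(1)] x(2) by metis
    have "y ^ CARD('a) = y" using y(2) m(2) by (simp add: power_mult mult.commute[of 2])
    moreover have "CARD('a) > 1" using m(2) \<open>m > 0\<close> by simp
    ultimately obtain v where v: "y = to_ac v"
      using power_card_eq_same_iff_in_range_to_ac by blast
    define s r where "s = (v - inverse v) / 2" and "r = (v + inverse v) / 2"
    have sr: "(y - inverse y) / 2 = to_ac s" "(y + inverse y) / 2 = to_ac r"
      by (simp_all add: v s_def r_def)
    have nz: "s \<noteq> 0" "r \<noteq> 0" using sr y two' by (metis divide_eq_0_iff to_ac_0)+
    have bs: "b = to_ac (s\<^sup>2)" "b + 1 = to_ac (r\<^sup>2)"
      using zh_eq_square_half_difference[OF two' y(3)] unfolding sr x(3) y(1) by simp_all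
    then have "to_ac (s\<^sup>2 + 1) = to_ac (r\<^sup>2)" by simp
    then have "s\<^sup>2 + 1 = r\<^sup>2" by (simp only: to_ac_eq_iff)
    then have "s\<^sup>2 \<in> D\<^sub>0 \<inter> (D\<^sub>0 \<ominus> 1)"
      using nz by (auto simp: mem_squares_iff)
    then show "b \<in> to_ac ` (D\<^sub>0 \<inter> (D\<^sub>0 \<ominus> 1) :: 'a set)" using bs by blast
  }
qed

text \<open>The square root \<open>S\<close> of a nonsquare lies outside the base field and is
  negated by the Frobenius map, which fixes \<open>R\<close>. Hence \<open>R + S\<close> goes to
  \<open>R - S\<close>, its inverse, and has order dividing p + 1 = 2m. Conversely, if the Frobenius
  map inverts \<open>y\<close>, it fixes the half sum and negates the half difference. Primality
  makes p-th powers additive.\<close>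

lemma to_ac_image_nonsquares_case_1_mod_4:
  assumes two: "(2::'a::{field,finite}) \<noteq> 0" and m: "odd m" "CARD('a) + 1 = 2 * m"
    and prime: "prime CARD('a)"
  shows "to_ac ` (D\<^sub>1 \<inter> (D\<^sub>0 \<ominus> 1) :: 'a set) = zh ` ({x. x ^ m = 1} - {1})"
proof (intro equalityI subsetI)
  let ?p = "CARD('a)"
  have two': "(2::'a alg_closure) \<noteq> 0" using two by (metis to_ac_eq_0_iff to_ac_numeral)
  have p1: "?p > 1" using prime prime_gt_1_nat by blast
  have "CHAR('a) = ?p"
    by (rule CHAR_eq_prime_CARD[OF prime])
  then have char: "CHAR('a alg_closure) = ?p" by simp
  have frob_add: "(x + y) ^ ?p = x ^ ?p + y ^ ?p" for x y :: "'a alg_closure"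
    by (rule freshmans_dream) (simp_all only: char prime)
  have frob_diff: "(x - y) ^ ?p = x ^ ?p - y ^ ?p" for x y :: "'a alg_closure"
    using frob_add[of "x - y" y] by (simp add: eq_diff_eq)
  have frob_iff: "z ^ ?p = z \<longleftrightarrow> z \<in> range to_ac" for z :: "'a alg_closure"
    by (rule power_card_eq_same_iff_in_range_to_ac[OF p1])
  have frob_two: "(2 :: 'a alg_closure) ^ ?p = 2"
    unfolding frob_iff by (metis rangeI to_ac_numeral)
  \<comment> \<open>This separates \<open>S\<close> from \<open>- S\<close>, so that an element
    negated by the Frobenius map is either 0 or outside the base field.\<close>
  have not_neg: "z = 0" if "z = - z" for z :: "'a alg_closure"
  proof -
    have "2 * z = 0" using that by (metis add.right_inverse mult_2)
    then show ?thesis using two' by simp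
  qed
  fix b :: "'a alg_closure"
  {
    assume "b \<in> to_ac ` (D\<^sub>1 \<inter> (D\<^sub>0 \<ominus> 1) :: 'a set)"
    then obtain a :: 'a where b: "b = to_ac a" and aD: "a \<in> D\<^sub>1" "a \<in> D\<^sub>0 \<ominus> 1" by blast
    from aD obtain r where a: "\<nexists>s. a = s\<^sup>2" "r\<^sup>2 = a + 1"
      by (metis mem_squares_iff(2,3))
    obtain S where S: "S\<^sup>2 = to_ac a" using nth_root_exists[of 2 "to_ac a"] by auto
    define R where "R = to_ac r"
    have RS: "R\<^sup>2 = S\<^sup>2 + 1" using a(2) S by (simp add: R_def flip: to_ac_power)
    have "S \<notin> range to_ac"
    proof
      assume "S \<in> range to_ac"
      then obtain s where "S = to_ac s" by blast
      then have "a = s\<^sup>2" using S by (metis to_ac_eq_iff to_ac_power)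
      then show False using a(1) by auto
    qed
    then have "S ^ ?p \<noteq> S" by (simp add: frob_iff)
    moreover have "(S ^ ?p)\<^sup>2 = S\<^sup>2"
    proof -
      have "(S ^ ?p)\<^sup>2 = to_ac a ^ ?p" by (metis S power_mult mult.commute)
      then show ?thesis using S by (simp add: power_card_eq_same flip: to_ac_power)
    qed
    ultimately have "S ^ ?p = - S" by (simp add: power2_eq_iff)
    moreover have "R ^ ?p = R" by (simp add: frob_iff R_def)
    ultimately have "(R + S) ^ ?p = R - S" by (simp add: frob_add)
    then have "(R + S) ^ Suc ?p = 1"
      using zh_square_of_sum(1,2)[OF two' RS] unfolding power_Suc by (metis right_inverse)
    then have "((R + S)\<^sup>2) ^ m = 1" using m(2) by (metis Suc_eq_plus1 power_mult)
    moreover have zx: "zh ((R + S)\<^sup>2) = b"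
      using zh_square_of_sum(3)[OF two' RS] S b by simp
    moreover have "(R + S)\<^sup>2 \<noteq> 1"
    proof
      assume "(R + S)\<^sup>2 = 1"
      then have "to_ac a = 0" using zx b by (simp add: zh_def)
      then show False using a(1) by auto
    qed
    ultimately show "b \<in> zh ` ({x. x ^ m = 1} - {1})" by blast
  next
    assume "b \<in> zh ` ({x. x ^ m = 1} - {1})"
    then obtain x where x: "x ^ m = 1" "x \<noteq> 1" "b = zh x" by blast
    obtain y where y: "x = y\<^sup>2" "y ^ m = 1" "y \<noteq> 0" "y - inverse y \<noteq> 0" "y + inverse y \<noteq> 0"
      using root_of_unity_odd_order[OF two' m(1) x(1)] x(2) by metis
    have "y ^ (?p + 1) = 1" unfolding m(2) using y(2) by (simp add: power_mult mult.commute[of 2])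
    then have "y * y ^ ?p = 1" by simp
    then have yp: "y ^ ?p = inverse y" by (metis inverse_unique)
    define S R where "S = (y - inverse y) / 2" and "R = (y + inverse y) / 2"
    have "S ^ ?p = - S"
      unfolding S_def by (simp add: power_divide frob_diff frob_two yp power_inverse flip: minus_divide_left)
    moreover have "S \<noteq> 0" using y two' by (simp add: S_def)
    ultimately have S: "S \<notin> range to_ac" using not_neg frob_iff by metis
    have "R ^ ?p = R"
      unfolding R_def by (simp add: power_divide frob_add frob_two yp power_inverse add.commute)
    then obtain r where r: "R = to_ac r" using frob_iff by blast
    have "r \<noteq> 0" using r y two' by (auto simp: R_def)
    have bS: "b = S\<^sup>2" "b + 1 = R\<^sup>2"
      using zh_eq_square_half_difference[OF two' y(3)] unfolding S_def R_def x(3) y(1) by simp_all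
    \<comment> \<open>Only \<open>R\<close> descends to the base field, so the preimage of
      \<open>b\<close> is read off from \<open>b + 1 = R\<^sup>2\<close>.\<close>
    define a where "a = r\<^sup>2 - 1"
    have ba: "b = to_ac a" using bS(2) by (simp add: a_def r algebra_simps)
    have "\<nexists>s. a = s\<^sup>2"
    proof
      assume "\<exists>s. a = s\<^sup>2"
      then obtain s where "a = s\<^sup>2" by blast
      then have "S\<^sup>2 = (to_ac s)\<^sup>2" using ba bS(1) by simp
      then have "S = to_ac s \<or> S = to_ac (- s)" by (simp add: power2_eq_iff)
      then show False using S by blast
    qed
    then have "a \<in> D\<^sub>1 \<inter> (D\<^sub>0 \<ominus> 1)"
      using \<open>r \<noteq> 0\<close> by (auto simp: mem_squares_iff a_def)
    then show "b \<in> to_ac ` (D\<^sub>1 \<inter> (D\<^sub>0 \<ominus> 1) :: 'a set)" using ba by blast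
  }
qed

theorem theorem14:
  fixes p m :: nat
  assumes "prime p" and "p > 3"
    and "CARD('a::{field,finite}) = p"
    and "odd m"
    and "[p = 3] (mod 4) \<Longrightarrow> p - 1 = 2 * m"
    and "[p = 1] (mod 4) \<Longrightarrow> p + 1 = 2 * m"
  shows "(\<forall>d. d dvd m \<and> d \<noteq> 1 \<longrightarrow> 2 * ord2' d dvd totient d) \<and>
         ([p = 3] (mod 4) \<longrightarrow>
            digraph_iso (state_diagram (\<lambda>a::'a. 4 * a * (a + 1)) (D\<^sub>0 \<inter> (D\<^sub>0 \<ominus> 1))) (cycle_union m)) \<and>
         ([p = 1] (mod 4) \<longrightarrow>
            digraph_iso (state_diagram (\<lambda>a::'a. 4 * a * (a + 1)) (D\<^sub>1 \<inter> (D\<^sub>0 \<ominus> 1))) (cycle_union m))"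
proof -
  have char: "CHAR('a) = p"
    using CHAR_eq_prime_CARD assms(1,3) by metis
  have "odd p" using assms(1,2) prime_odd_nat by simp
  \<comment> \<open>The divisibility claim carries no premise on p modulo 4, so the two residue
    classes must be seen to be exhaustive.\<close>
  then have cases: "[p = 3] (mod 4) \<or> [p = 1] (mod 4)"
    by (simp add: cong_def) presburger
  have excl: "\<not> ([p = 3] (mod 4) \<and> [p = 1] (mod 4))"
    by (auto simp: cong_def)
  have small: "of_nat n \<noteq> (0::'a)" if "0 < n" "n < p" for n
    using that by (simp add: of_nat_eq_0_iff_char_dvd char nat_dvd_not_less)
  have two: "(2::'a) \<noteq> 0" using small[of 2] assms(2) by simp
  \<comment> \<open>As half of \<open>p - 1\<close> or of \<open>p + 1\<close>, \<open>m\<close> is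
    smaller than the characteristic and hence nonzero in the field.\<close>
  have "0 < m \<and> m < p" using cases assms(2,4,5,6) by (auto intro: Nat.gr0I)
  then have m: "of_nat m \<noteq> (0::'a)" using small by blast
  show ?thesis
  proof (cases "[p = 3] (mod 4)")
    case True
    then have "CARD('a) = 2 * m + 1" using assms(2,3,5) by simp
    from state_diagram_zh_image[OF two m assms(4) to_ac_image_squares_case_3_mod_4[OF two assms(4) this]]
    show ?thesis using True excl by blast
  next
    case False
    then have "CARD('a) + 1 = 2 * m" using assms(3,6) cases by simp
    moreover have "prime CARD('a)" using assms(1,3) by simp
    ultimately have "to_ac ` (D\<^sub>1 \<inter> (D\<^sub>0 \<ominus> 1) :: 'a set) = zh ` ({x. x ^ m = 1} - {1})"
      by (intro to_ac_image_nonsquares_case_1_mod_4[OF two assms(4)])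
    from state_diagram_zh_image[OF two m assms(4) this]
    show ?thesis using False by blast
  qed
qed

end
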